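(* Let $Q=\{q_0,q_1,q_2\}$ and $S=\{0,1\}$, and consider all Mealy automata $(Q,S,\varphi,\psi)$ (there are $46656$ of them). Exactly $720$ of them are bijective. Among these bijective automata, exactly $592$ are transitive, exactly $84$ are particle-preserving, and exactly $68$ are both transitive and particle-preserving. Of these $68$ automata exactly $42$ are minimal, and these $42$ automata fall into exactly seven classes up to permutation of the three states, represented by MA-$[3,2,104,11]$, MA-$[3,2,146,7]$, MA-$[3,2,128,19]$, MA-$[3,2,154,7]$, MA-$[3,2,318,52]$, MA-$[3,2,106,13]$, MA-$[3,2,266,19]$. Among these seven classes, exactly three consist of automata that are locally interacting with respect to $V=\{0\}$, namely those of MA-$[3,2,104,11]$, MA-$[3,2,146,7]$ and MA-$[3,2,154,7]$.
   Context: A Mealy automaton $(Q,S,\varphi,\psi)$ consists of a non-empty set of states $Q$, a non-empty alphabet $S$, a transition function $\varphi:Q\times S\to Q$ and an exit function $\psi:Q\times S\to S$. Both extend to words: for $\bm{s}=s_1\cdots s_n\in S^*$ put $p_1=q$, $p_{j+1}=\varphi(p_j,s_j)$; then $\varphi(q,\bm{s})=p_{n+1}\in Q$ and $\psi(q,\bm{s})=\psi(p_1,s_1)\cdots\psi(p_n,s_n)\in S^n$. $S^*$ is the set of all finite words over $S$, including the empty word. The automaton is: - bijective if $(q,s)\mapsto(\varphi(q,s),\psi(q,s))$ is a bijection of $Q\times S$; - transitive if for all $q,q'\in Q$ there is a word $\bm{s}\in S^*$ with $\varphi(q,\bm{s})=q'$; - particle-preserving if there is a weight function $w:Q\cup S\to\mathbb{R}$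 ($Q$ and $S$ regarded as disjoint), not constant on $S$, with $w(q)+w(s)=w(\varphi(q,s))+w(\psi(q,s))$ for all $(q,s)\in Q\times S$; - minimal if for any distinct $q,r\in Q$ there is $\bm{s}\in S^*$ with $\psi(q,\bm{s})\neq\psi(r,\bm{s})$; - locally interacting with respect to $V\subset S$ if for all $\bm{s}_1,\bm{s}_2\in S^*$ there exist $\bm{s},\bm{s}'\in V^*$ and $q\in Q$ such that $\bm{s}_1\bm{s}$ and $\bm{s}_2\bm{s}'$ have the same length and $\psi(\varphi(q,\bm{s}_1\bm{s}),\bm{s}_3)=\psi(\varphi(q,\bm{s}_2\bm{s}'),\bm{s}_3)$ for all $\bm{s}_3\in S^*$. Two automata $(Q,S,\varphi,\psi)$ and $(Q,S,\tilde\varphi,\tilde\psi)$ agree up to permutation of states if there is a permutation $\sigma$ of $Q$ with $\tilde\varphi(q,s)=\sigma(\varphi(\sigma^{-1}(q),s))$ and $\tilde\psi(q,s)=\psi(\sigma^{-1}(q),s)$ for all $q\in Q$, $s\in S$. MA-$[m,n,k,l]$ denotes the automaton with $Q=\{q_0,\dots,q_{m-1}\}$, $S=\{0,\dots,n-1\}$, $\varphi(q_i,j)=q_{f(i,j)}$, $\psi(q_i,j)=g(i,j)$, where $f(i,j)\in\{0,\dots,m-1\}$ and $g(i,j)\in\{0,\dots,n-1\}$ are the digits in $k=\sum_{i=0}^{m-1}\sum_{j=0}^{n-1}f(i,j)\,m^{mn-in-j-1}$ and $l=\sum_{i=0}^{m-1}\sum_{j=0}^{n-1}g(i,j)\,n^{mn-in-j-1}$.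 *)

theory Defs
  imports Complex_Main "HOL-Library.FuncSet" "HOL-Combinatorics.Permutations"
begin

record ('q, 's) mealy =
  states :: "'q set"
  letters :: "'s set"
  transition :: "'q \<times> 's \<Rightarrow> 'q"
  exit_fun :: "'q \<times> 's \<Rightarrow> 's"

(* The two functions are extensional (PiE), so that equality of records is equality
   of automata and finite sets of automata have the expected cardinality. *)
definition mealy_automata :: "'q set \<Rightarrow> 's set \<Rightarrow> ('q, 's) mealy set" where
  "mealy_automata Q S =
     {A. states A = Q \<and> letters A = S \<and> Q \<noteq> {} \<and> S \<noteq> {} \<and>
         transition A \<in> Q \<times> S \<rightarrow>\<^sub>E Q \<and> exit_fun A \<in> Q \<times> S \<rightarrow>\<^sub>E S}"

fun transition_word :: "('q, 's) mealy \<Rightarrow> 'q \<Rightarrow> 's list \<Rightarrow> 'q" where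
  "transition_word A q [] = q"
| "transition_word A q (s # w) = transition_word A (transition A (q, s)) w"

fun exit_word :: "('q, 's) mealy \<Rightarrow> 'q \<Rightarrow> 's list \<Rightarrow> 's list" where
  "exit_word A q [] = []"
| "exit_word A q (s # w) = exit_fun A (q, s) # exit_word A (transition A (q, s)) w"

definition bijective :: "('q, 's) mealy \<Rightarrow> bool" where
  "bijective A \<longleftrightarrow>
     bij_betw (\<lambda>(q, s). (transition A (q, s), exit_fun A (q, s)))
       (states A \<times> letters A) (states A \<times> letters A)"

definition transitive :: "('q, 's) mealy \<Rightarrow> bool" where
  "transitive A \<longleftrightarrow>
     (\<forall>q \<in> states A. \<forall>q' \<in> states A. \<exists>w \<in> lists (letters A). transition_word A q w = q')"

definition particle_preserving :: "('q, 's) mealy \<Rightarrow> bool" where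
  "particle_preserving A \<longleftrightarrow>
     (\<exists>w :: 'q + 's \<Rightarrow> real.
        \<not> (\<exists>c. \<forall>s \<in> letters A. w (Inr s) = c) \<and>
        (\<forall>q \<in> states A. \<forall>s \<in> letters A.
           w (Inl q) + w (Inr s) = w (Inl (transition A (q, s))) + w (Inr (exit_fun A (q, s)))))"

definition minimal :: "('q, 's) mealy \<Rightarrow> bool" where
  "minimal A \<longleftrightarrow>
     (\<forall>q \<in> states A. \<forall>r \<in> states A. q \<noteq> r \<longrightarrow>
        (\<exists>w \<in> lists (letters A). exit_word A q w \<noteq> exit_word A r w))"

definition locally_interacting :: "('q, 's) mealy \<Rightarrow> 's set \<Rightarrow> bool" where
  "locally_interacting A V \<longleftrightarrow> V \<subseteq> letters A \<and>
     (\<forall>s1 \<in> lists (letters A). \<forall>s2 \<in> lists (letters A).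
        \<exists>s \<in> lists V. \<exists>s' \<in> lists V. \<exists>q \<in> states A.
          length (s1 @ s) = length (s2 @ s') \<and>
          (\<forall>s3 \<in> lists (letters A).
             exit_word A (transition_word A q (s1 @ s)) s3 =
             exit_word A (transition_word A q (s2 @ s')) s3))"

definition agree_up_to_states :: "('q, 's) mealy \<Rightarrow> ('q, 's) mealy \<Rightarrow> bool" where
  "agree_up_to_states A B \<longleftrightarrow> states B = states A \<and> letters B = letters A \<and>
     (\<exists>\<sigma>. \<sigma> permutes states A \<and>
        (\<forall>q \<in> states A. \<forall>s \<in> letters A.
           transition B (q, s) = \<sigma> (transition A (inv \<sigma> q, s)) \<and>
           exit_fun B (q, s) = exit_fun A (inv \<sigma> q, s)))"

(* The state q_i is the number i.  The description is proper for k < m ^ (m * n) and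
   l < n ^ (m * n), where base-m and base-n expansions exist and are unique; the
   exponents m * n - i * n - j - 1 are then free of truncation, as i < m and j < n. *)
definition MA :: "nat \<Rightarrow> nat \<Rightarrow> nat \<Rightarrow> nat \<Rightarrow> (nat, nat) mealy" where
  "MA m n k l = (THE A. A \<in> mealy_automata {..<m} {..<n} \<and>
     k = (\<Sum>i<m. \<Sum>j<n. transition A (i, j) * m ^ (m * n - i * n - j - 1)) \<and>
     l = (\<Sum>i<m. \<Sum>j<n. exit_fun A (i, j) * n ^ (m * n - i * n - j - 1)))"

end

theory Submission
  imports Defs "HOL-Combinatorics.Multiset_Permutations"
begin

text \<open>
  A bijective automaton is the list of the images of the six pairs of a state and a letter, hence one
  of the \<open>720\<close> orderings of these pairs.  Each property is equivalent to a statement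
  about finitely many candidates: proper subsets closed under the transitions, integer potentials on
  the states with values in \<open>{0, 1, 2}\<close>, non-injective congruences, and permutations of
  the states.  The counts are then obtained by inspecting all orderings.  Local interaction is decided
  by the action of the letter \<open>0\<close> on the states: in three of the seven representatives two
  letters \<open>0\<close> reset the automaton, and in the other four \<open>0\<close> permutes its own image,
  so that two suitable words of equal length lead to states that never merge.
\<close>

section \<open>Decidable characterisations\<close>

lemma transition_in_states:
  assumes "A \<in> mealy_automata Q S" "q \<in> Q" "s \<in> S"
  shows "transition A (q, s) \<in> Q"
  using assms unfolding mealy_automata_def by auto

lemma exit_in_letters:
  assumes "A \<in> mealy_automata Q S" "q \<in> Q" "s \<in> S"
  shows "exit_fun A (q, s) \<in> S"
  using assms unfolding mealy_automata_def by auto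

lemma states_letters:
  assumes "A \<in> mealy_automata Q S"
  shows "states A = Q" "letters A = S"
  using assms unfolding mealy_automata_def by auto

lemma transition_word_append:
  "transition_word A q (v @ w) = transition_word A (transition_word A q v) w"
  by (induction v arbitrary: q) auto

lemma transition_word_in_states:
  assumes "A \<in> mealy_automata Q S" "q \<in> Q" "w \<in> lists S"
  shows "transition_word A q w \<in> Q"
  using assms(2,3)
  by (induction w arbitrary: q) (auto intro: transition_in_states[OF assms(1)])

lemma mealy_eqI:
  assumes A: "A \<in> mealy_automata Q S" and B: "B \<in> mealy_automata Q S"
    and eq: "\<And>q s. q \<in> Q \<Longrightarrow> s \<in> S \<Longrightarrow>
      transition A (q, s) = transition B (q, s) \<and> exit_fun A (q, s) = exit_fun B (q, s)"
  shows "A = B"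
proof (rule mealy.equality)
  show "transition A = transition B"
    using A B eq unfolding mealy_automata_def
    by (intro PiE_ext[of "transition A" "Q \<times> S" "\<lambda>_. Q"]) auto
  show "exit_fun A = exit_fun B"
    using A B eq unfolding mealy_automata_def
    by (intro PiE_ext[of "exit_fun A" "Q \<times> S" "\<lambda>_. S"]) auto
qed (simp_all add: states_letters[OF A] states_letters[OF B])

text \<open>An automaton amounts to a pair of extensional functions, and
  \<open>card Q ^ n * card S ^ n\<close> with \<open>n = card Q * card S\<close> collapses to one
  power.\<close>

lemma card_mealy_automata:
  assumes "finite Q" "finite S" "Q \<noteq> {}" "S \<noteq> {}"
  shows "card (mealy_automata Q S) = (card Q * card S) ^ (card Q * card S)"
proof -
  have "bij_betw (\<lambda>(f, g). \<lparr>states = Q, letters = S, transition = f, exit_fun = g\<rparr>)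
          ((Q \<times> S \<rightarrow>\<^sub>E Q) \<times> (Q \<times> S \<rightarrow>\<^sub>E S)) (mealy_automata Q S)"
    unfolding bij_betw_def
  proof
    show "inj_on (\<lambda>(f, g). \<lparr>states = Q, letters = S, transition = f, exit_fun = g\<rparr>)
        ((Q \<times> S \<rightarrow>\<^sub>E Q) \<times> (Q \<times> S \<rightarrow>\<^sub>E S))"
      by (rule inj_onI) (simp add: split_beta prod_eq_iff)
    show "(\<lambda>(f, g). \<lparr>states = Q, letters = S, transition = f, exit_fun = g\<rparr>) `
        ((Q \<times> S \<rightarrow>\<^sub>E Q) \<times> (Q \<times> S \<rightarrow>\<^sub>E S)) = mealy_automata Q S"
    proof (intro equalityI subsetI)
      fix A assume "A \<in> mealy_automata Q S"
      then show "A \<in> (\<lambda>(f, g). \<lparr>states = Q, letters = S, transition = f, exit_fun = g\<rparr>) `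
          ((Q \<times> S \<rightarrow>\<^sub>E Q) \<times> (Q \<times> S \<rightarrow>\<^sub>E S))"
        unfolding mealy_automata_def by (intro image_eqI[of _ _ "(transition A, exit_fun A)"]) simp_all
    next
      fix A assume "A \<in> (\<lambda>(f, g). \<lparr>states = Q, letters = S, transition = f, exit_fun = g\<rparr>) `
          ((Q \<times> S \<rightarrow>\<^sub>E Q) \<times> (Q \<times> S \<rightarrow>\<^sub>E S))"
      then obtain f g where "A = \<lparr>states = Q, letters = S, transition = f, exit_fun = g\<rparr>"
        "f \<in> Q \<times> S \<rightarrow>\<^sub>E Q" "g \<in> Q \<times> S \<rightarrow>\<^sub>E S"
        by auto
      then show "A \<in> mealy_automata Q S"
        using assms by (simp add: mealy_automata_def)
    qed
  qed
  then have "card (mealy_automata Q S) = card ((Q \<times> S \<rightarrow>\<^sub>E Q) \<times> (Q \<times> S \<rightarrow>\<^sub>E S))"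
    by (metis bij_betw_same_card)
  then show ?thesis
    using assms by (simp add: card_cartesian_product card_funcsetE power_mult_distrib)
qed

text \<open>A closed set traps every run that enters it, and the states reachable from a given state
  form a non-empty closed set. This trades infinitely many words for finitely many subsets.\<close>

lemma transitive_iff_closed_subsets:
  assumes A: "A \<in> mealy_automata Q S"
  shows "transitive A \<longleftrightarrow>
    (\<forall>U \<subseteq> Q. U \<noteq> {} \<longrightarrow> (\<forall>q \<in> U. \<forall>s \<in> S. transition A (q, s) \<in> U) \<longrightarrow> U = Q)"
    (is "_ \<longleftrightarrow> ?closed")
proof
  note [simp] = states_letters[OF A]
  assume tr: "transitive A"
  show ?closed
  proof (intro allI impI)
    fix U assume U: "U \<subseteq> Q" "U \<noteq> {}" "\<forall>q \<in> U. \<forall>s \<in> S. transition A (q, s) \<in> U"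
    have closed: "transition_word A q w \<in> U" if "q \<in> U" "w \<in> lists S" for q w
      using that U(3) by (induction w arbitrary: q) auto
    obtain q where q: "q \<in> U" using U(2) by blast
    have "q' \<in> U" if "q' \<in> Q" for q'
    proof -
      have "q \<in> Q" using q U(1) by blast
      then obtain w where "w \<in> lists S" "transition_word A q w = q'"
        using tr \<open>q' \<in> Q\<close> unfolding transitive_def states_letters[OF A] by blast
      then show ?thesis using closed[OF q] by blast
    qed
    then show "U = Q" using U(1) by blast
  qed
next
  assume closed: ?closed
  have "\<exists>w \<in> lists S. transition_word A q w = q'" if q: "q \<in> Q" and q': "q' \<in> Q" for q q'
  proof -
    define U where "U = transition_word A q ` lists S"
    have "q \<in> U" unfolding U_def by (rule image_eqI[of _ _ "[]"]) auto
    moreover have "U \<subseteq> Q"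
      using transition_word_in_states[OF A q] by (auto simp: U_def)
    moreover have "transition A (r, s) \<in> U" if r: "r \<in> U" and s: "s \<in> S" for r s
    proof -
      obtain w where "w \<in> lists S" "r = transition_word A q w"
        using r by (auto simp: U_def)
      then show ?thesis
        using s unfolding U_def
        by (intro image_eqI[of _ _ "w @ [s]"]) (auto simp: transition_word_append)
    qed
    ultimately have "U = Q" using closed by blast
    then show ?thesis using q' by (auto simp: U_def)
  qed
  then show "transitive A" unfolding transitive_def by (simp add: states_letters[OF A])
qed

text \<open>A congruence is represented as the kernel of a map \<open>c\<close> on the states.
  Congruent states have equal exit words by induction on the word; conversely, having equal exit
  words is itself a congruence, so injectivity of its \<open>c\<close> separates all states.\<close>

lemma minimal_iff_no_congruence:
  assumes A: "A \<in> mealy_automata Q S"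
  shows "minimal A \<longleftrightarrow>
    (\<forall>c \<in> Q \<rightarrow> Q. (\<forall>q \<in> Q. \<forall>r \<in> Q. c q = c r \<longrightarrow> (\<forall>s \<in> S. exit_fun A (q, s) = exit_fun A (r, s) \<and>
        c (transition A (q, s)) = c (transition A (r, s)))) \<longrightarrow> inj_on c Q)"
    (is "_ \<longleftrightarrow> (\<forall>c \<in> _. ?congruence c \<longrightarrow> _)")
proof
  assume min: "minimal A"
  show "\<forall>c \<in> Q \<rightarrow> Q. ?congruence c \<longrightarrow> inj_on c Q"
  proof (intro ballI impI inj_onI)
    fix c q r assume c: "?congruence c" and qr: "q \<in> Q" "r \<in> Q" "c q = c r"
    have congD: "exit_fun A (q, s) = exit_fun A (r, s) \<and> c (transition A (q, s)) = c (transition A (r, s))"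
      if "q \<in> Q" "r \<in> Q" "c q = c r" "s \<in> S" for q r s
      using c[rule_format, of q r s] that by simp
    have "exit_word A q w = exit_word A r w" if "w \<in> lists S" for w
      using that qr
    proof (induction w arbitrary: q r rule: lists.induct)
      case (Cons s w)
      have "exit_word A (transition A (q, s)) w = exit_word A (transition A (r, s)) w"
        using Cons.hyps Cons.prems congD by (intro Cons.IH transition_in_states[OF A]) blast+
      then show ?case using congD[OF Cons.prems Cons.hyps(1)] by simp
    qed simp
    then show "q = r" using min qr unfolding minimal_def states_letters[OF A] by blast
  qed
next
  assume inj: "\<forall>c \<in> Q \<rightarrow> Q. ?congruence c \<longrightarrow> inj_on c Q"
  define eq where "eq q r \<longleftrightarrow> (\<forall>w \<in> lists S. exit_word A q w = exit_word A r w)" for q r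
  \<comment> \<open>The choice depends only on the predicate \<open>eq q\<close>, so equivalent
    states receive the very same representative.\<close>
  define c where "c q = (SOME r. r \<in> Q \<and> eq q r)" for q
  have c: "c q \<in> Q \<and> eq q (c q)" if "q \<in> Q" for q
  proof -
    have "q \<in> Q \<and> eq q q" using that by (simp add: eq_def)
    then show ?thesis unfolding c_def by (rule someI)
  qed
  have c_eq: "c q = c r \<longleftrightarrow> eq q r" if "q \<in> Q" "r \<in> Q" for q r
  proof
    assume "c q = c r"
    then show "eq q r" using c[OF that(1)] c[OF that(2)] by (auto simp: eq_def)
  next
    assume "eq q r"
    then have "eq q = eq r" by (auto simp: eq_def)
    then show "c q = c r" unfolding c_def by simp
  qed
  have "?congruence c"
  proof (intro ballI impI)
    fix q r s assume qr: "q \<in> Q" "r \<in> Q" "c q = c r" and s: "s \<in> S"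
    \<comment> \<open>Testing on \<open>s # w\<close> yields both halves of the congruence: the
      first letter compares the exits at \<open>s\<close>, the remaining letters compare the
      successor states.\<close>
    have "exit_word A q (s # w) = exit_word A r (s # w)" if "w \<in> lists S" for w
    proof -
      have "eq q r" using qr c_eq by blast
      then show ?thesis unfolding eq_def by (rule bspec) (simp add: s that)
    qed
    from this this[of "[]"] show "exit_fun A (q, s) = exit_fun A (r, s) \<and>
        c (transition A (q, s)) = c (transition A (r, s))"
      using qr s c_eq transition_in_states[OF A] by (auto simp: eq_def)
  qed
  then have "inj_on c Q" using inj c by blast
  then have "\<not> eq q r" if "q \<in> Q" "r \<in> Q" "q \<noteq> r" for q r
    using that c_eq unfolding inj_on_def by blast
  then show "minimal A" unfolding minimal_def eq_def by (auto simp: states_letters[OF A])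
qed

text \<open>
  Normalising the weights of the letters to \<open>0\<close> and \<open>1\<close> turns conservation into a system of equations
  with integer constants between \<open>-1\<close> and \<open>1\<close>.  Such systems are respected by rounding down, and
  then by replacing each value with its rank among the values attained.
\<close>
lemma particle_preserving_iff_potential:
  fixes A :: "('q, nat) mealy"
  assumes A: "A \<in> mealy_automata Q {0, 1}" and fin: "finite Q"
  shows "particle_preserving A \<longleftrightarrow>
    (\<exists>h \<in> Q \<rightarrow> {..<card Q}. \<forall>q \<in> Q. \<forall>s \<in> {0, 1}. h q + s = h (transition A (q, s)) + exit_fun A (q, s))"
    (is "_ \<longleftrightarrow> (\<exists>h \<in> _. ?potential h)")
proof
  assume "particle_preserving A"
  then obtain w :: "'q + nat \<Rightarrow> real" where "\<not> (\<exists>c. \<forall>s \<in> {0, 1 :: nat}. w (Inr s) = c)"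
    and cons: "\<forall>q \<in> Q. \<forall>s \<in> {0, 1}.
      w (Inl q) + w (Inr s) = w (Inl (transition A (q, s))) + w (Inr (exit_fun A (q, s)))"
    unfolding particle_preserving_def states_letters[OF A] by (elim exE conjE)
  then have nc: "w (Inr 0) \<noteq> w (Inr 1)" by auto
  have w: "w (Inl q) + w (Inr s) = w (Inl (transition A (q, s))) + w (Inr (exit_fun A (q, s)))"
    if "q \<in> Q" "s \<in> {0, 1}" for q s
    using that cons by blast
  \<comment> \<open>This difference may be negative but is not zero, as \<open>w\<close> is not
    constant on the letters. After division by \<open>d\<close> the letter weights differ by exactly
    1.\<close>
  define d where "d = w (Inr 1) - w (Inr 0)"
  have d: "d \<noteq> 0" using nc by (simp add: d_def)
  have wr: "w (Inr s) = w (Inr 0) + d * real s" if "s \<in> {0, 1}" for s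
    using that by (auto simp: d_def)
  define k where "k q = \<lfloor>w (Inl q) / d\<rfloor>" for q
  have k: "k q + int s = k (transition A (q, s)) + int (exit_fun A (q, s))"
    if q: "q \<in> Q" and s: "s \<in> {0, 1}" for q s
  proof -
    have "w (Inl q) + d * real s = w (Inl (transition A (q, s))) + d * real (exit_fun A (q, s))"
      using w[OF q s] wr[OF s] wr[OF exit_in_letters[OF A q s]] by linarith
    then have "w (Inl q) / d + real_of_int (int s)
        = w (Inl (transition A (q, s))) / d + real_of_int (int (exit_fun A (q, s)))"
      using d by (simp add: field_simps)
    then show ?thesis unfolding k_def by (metis floor_add_int)
  qed
  define h where "h q = card {i \<in> k ` Q. i < k q}" for q
  \<comment> \<open>Passing from \<open>k q\<close> to \<open>k q + 1\<close> adds one integer to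
    those below, namely \<open>k q\<close>, and this one is attained. Hence ranks preserve steps of
    size one.\<close>
  have step: "h r = Suc (h q)" if "q \<in> Q" "k r = k q + 1" for q r
  proof -
    have "{i \<in> k ` Q. i < k r} = insert (k q) {i \<in> k ` Q. i < k q}"
      using that by auto
    then show ?thesis using fin by (simp add: h_def)
  qed
  have "?potential h"
  proof (intro ballI)
    fix q s assume q: "q \<in> Q" and s: "s \<in> {0, 1 :: nat}"
    let ?r = "transition A (q, s)" and ?t = "exit_fun A (q, s)"
    have r: "?r \<in> Q" and t: "?t \<in> {0, 1}"
      using transition_in_states[OF A q s] exit_in_letters[OF A q s] .
    consider "s = ?t" "k q = k ?r" | "s = 1" "?t = 0" "k ?r = k q + 1" | "s = 0" "?t = 1" "k q = k ?r + 1"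
      using k[OF q s] s t by auto
    then show "h q + s = h ?r + ?t"
    proof cases
      case 1 then show ?thesis by (simp add: h_def)
    next
      case 2 then show ?thesis using step[OF q] by simp
    next
      case 3 then show ?thesis using step[OF r] by simp
    qed
  qed
  moreover have "h q < card Q" if "q \<in> Q" for q
  proof -
    \<comment> \<open>The value \<open>k q\<close> is attained but does not lie below itself, so a
      rank is less than the number of attained values.\<close>
    have "{i \<in> k ` Q. i < k q} \<subset> k ` Q" using that by auto
    then have "h q < card (k ` Q)" unfolding h_def using fin by (simp add: psubset_card_mono)
    then show ?thesis using card_image_le[OF fin, of k] by linarith
  qed
  ultimately show "\<exists>h \<in> Q \<rightarrow> {..<card Q}. ?potential h" by blast
next
  assume "\<exists>h \<in> Q \<rightarrow> {..<card Q}. ?potential h"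
  then obtain h where h: "?potential h" by blast
  show "particle_preserving A"
    unfolding particle_preserving_def
  proof (intro exI[of _ "\<lambda>x. case x of Inl q \<Rightarrow> real (h q) | Inr s \<Rightarrow> real s"] conjI ballI)
    fix q s assume "q \<in> states A" "s \<in> letters A"
    then have "h q + s = h (transition A (q, s)) + exit_fun A (q, s)"
      using h by (auto simp: states_letters[OF A])
    then show "(case Inl q of Inl q \<Rightarrow> real (h q) | Inr s \<Rightarrow> real s) + (case Inr s of Inl q \<Rightarrow> real (h q) | Inr s \<Rightarrow> real s) =
      (case Inl (transition A (q, s)) of Inl q \<Rightarrow> real (h q) | Inr s \<Rightarrow> real s) +
      (case Inr (exit_fun A (q, s)) of Inl q \<Rightarrow> real (h q) | Inr s \<Rightarrow> real s)"
      by (simp flip: of_nat_add)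
  qed (auto simp: states_letters[OF A])
qed

section \<open>Renaming states\<close>

text \<open>Reindexing the states of \<open>B\<close> by the bijection \<open>\<sigma>\<close>
  removes the inverse and shows \<open>\<sigma>\<close> as an isomorphism that fixes the
  letters.\<close>

lemma agree_up_to_states_iff:
  assumes A: "A \<in> mealy_automata Q S" and B: "B \<in> mealy_automata Q S"
  shows "agree_up_to_states A B \<longleftrightarrow>
    (\<exists>\<sigma>. \<sigma> permutes Q \<and> (\<forall>q \<in> Q. \<forall>s \<in> S.
       transition B (\<sigma> q, s) = \<sigma> (transition A (q, s)) \<and> exit_fun B (\<sigma> q, s) = exit_fun A (q, s)))"
proof -
  have "(\<forall>q \<in> Q. \<forall>s \<in> S. transition B (q, s) = \<sigma> (transition A (inv \<sigma> q, s)) \<and>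
           exit_fun B (q, s) = exit_fun A (inv \<sigma> q, s)) \<longleftrightarrow>
        (\<forall>q \<in> Q. \<forall>s \<in> S. transition B (\<sigma> q, s) = \<sigma> (transition A (q, s)) \<and>
           exit_fun B (\<sigma> q, s) = exit_fun A (q, s))"
    if \<sigma>: "\<sigma> permutes Q" for \<sigma>
  proof -
    have "(\<forall>q \<in> Q. P q) \<longleftrightarrow> (\<forall>q \<in> Q. P (\<sigma> q))" for P
      by (subst permutes_image[OF \<sigma>, symmetric]) (rule ball_simps)
    from this[of "\<lambda>q. \<forall>s \<in> S. transition B (q, s) = \<sigma> (transition A (inv \<sigma> q, s)) \<and>
        exit_fun B (q, s) = exit_fun A (inv \<sigma> q, s)"]
    show ?thesis by (simp only: permutes_inverses[OF \<sigma>])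
  qed
  then show ?thesis unfolding agree_up_to_states_def states_letters[OF A] states_letters[OF B]
    by (simp cong: conj_cong)
qed

text \<open>Only the values of the renaming on \<open>Q\<close> matter, and on a finite set an
  injective self-map is a permutation. The search for a renaming thus becomes finite.\<close>

lemma agree_up_to_states_iff_inj_on:
  assumes A: "A \<in> mealy_automata Q S" and B: "B \<in> mealy_automata Q S" and fin: "finite Q"
  shows "agree_up_to_states A B \<longleftrightarrow>
    (\<exists>\<sigma> \<in> Q \<rightarrow> Q. inj_on \<sigma> Q \<and> (\<forall>q \<in> Q. \<forall>s \<in> S.
       transition B (\<sigma> q, s) = \<sigma> (transition A (q, s)) \<and> exit_fun B (\<sigma> q, s) = exit_fun A (q, s)))"
    (is "_ \<longleftrightarrow> ?inj")
proof
  assume "agree_up_to_states A B"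
  then obtain \<sigma> where "\<sigma> permutes Q" "\<forall>q \<in> Q. \<forall>s \<in> S.
      transition B (\<sigma> q, s) = \<sigma> (transition A (q, s)) \<and> exit_fun B (\<sigma> q, s) = exit_fun A (q, s)"
    using agree_up_to_states_iff[OF A B] by blast
  then show ?inj by (intro bexI[of _ \<sigma>]) (auto simp: permutes_inj_on permutes_in_image)
next
  assume ?inj
  then obtain \<sigma> where \<sigma>: "\<sigma> \<in> Q \<rightarrow> Q" "inj_on \<sigma> Q" and eq: "\<And>q s. q \<in> Q \<Longrightarrow> s \<in> S \<Longrightarrow>
      transition B (\<sigma> q, s) = \<sigma> (transition A (q, s)) \<and> exit_fun B (\<sigma> q, s) = exit_fun A (q, s)"
    by blast
  \<comment> \<open>Outside \<open>Q\<close> the default is the identity, as \<open>permutes\<close>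
    demands.\<close>
  define \<tau> where "\<tau> q = (if q \<in> Q then \<sigma> q else q)" for q
  have "bij_betw \<sigma> Q Q"
    using \<sigma> fin by (simp add: bij_betw_def endo_inj_surj image_subset_iff_funcset)
  then have "bij_betw \<tau> Q Q" by (rule bij_betw_cong[THEN iffD1, rotated]) (simp add: \<tau>_def)
  then have "\<tau> permutes Q" by (rule bij_imp_permutes) (simp add: \<tau>_def)
  moreover have "\<forall>q \<in> Q. \<forall>s \<in> S.
      transition B (\<tau> q, s) = \<tau> (transition A (q, s)) \<and> exit_fun B (\<tau> q, s) = exit_fun A (q, s)"
    using eq transition_in_states[OF A] by (simp add: \<tau>_def)
  ultimately show "agree_up_to_states A B" using agree_up_to_states_iff[OF A B] by blast
qed

text \<open>Reflexivity, symmetry and transitivity come from the identity, inverses and composites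
  of permutations.\<close>

lemma equiv_agree_up_to_states:
  assumes "M \<subseteq> mealy_automata Q S"
  shows "equiv M {(A, B). A \<in> M \<and> B \<in> M \<and> agree_up_to_states A B}"
proof (rule equivI)
  have states_letters_M: "states A = Q" "letters A = S" if "A \<in> M" for A
    using assms that states_letters by blast+
  show "refl_on M {(A, B). A \<in> M \<and> B \<in> M \<and> agree_up_to_states A B}"
    by (auto simp: refl_on_def agree_up_to_states_def intro!: exI[of _ id] permutes_id)
  show "sym {(A, B). A \<in> M \<and> B \<in> M \<and> agree_up_to_states A B}"
  proof (rule symI, clarify)
    fix A B assume AB: "A \<in> M" "B \<in> M" "agree_up_to_states A B"
    then obtain \<sigma> where \<sigma>: "\<sigma> permutes Q" "\<forall>q \<in> Q. \<forall>s \<in> S. transition B (q, s) = \<sigma> (transition A (inv \<sigma> q, s)) \<and> exit_fun B (q, s) = exit_fun A (inv \<sigma> q, s)"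
      by (auto simp: agree_up_to_states_def states_letters_M)
    have "\<forall>q \<in> Q. \<forall>s \<in> S. transition A (inv \<sigma> q, s) = inv \<sigma> (transition B (q, s)) \<and> exit_fun A (inv \<sigma> q, s) = exit_fun B (q, s)"
      using \<sigma> by (simp add: permutes_inverses)
    then show "agree_up_to_states B A"
      using \<sigma>(1) AB(1,2) assms agree_up_to_states_iff[of B Q S A] permutes_inv by blast
  qed
  show "trans {(A, B). A \<in> M \<and> B \<in> M \<and> agree_up_to_states A B}"
  proof (rule transI, clarify)
    fix A B C assume M: "A \<in> M" "B \<in> M" "C \<in> M"
      and AB: "agree_up_to_states A B" and BC: "agree_up_to_states B C"
    have mem: "A \<in> mealy_automata Q S" "B \<in> mealy_automata Q S" "C \<in> mealy_automata Q S"
      using M assms by auto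
    obtain \<sigma> where \<sigma>: "\<sigma> permutes Q" "\<forall>q \<in> Q. \<forall>s \<in> S.
        transition B (\<sigma> q, s) = \<sigma> (transition A (q, s)) \<and> exit_fun B (\<sigma> q, s) = exit_fun A (q, s)"
      using AB agree_up_to_states_iff[OF mem(1,2)] by blast
    obtain \<tau> where \<tau>: "\<tau> permutes Q" "\<forall>q \<in> Q. \<forall>s \<in> S.
        transition C (\<tau> q, s) = \<tau> (transition B (q, s)) \<and> exit_fun C (\<tau> q, s) = exit_fun B (q, s)"
      using BC agree_up_to_states_iff[OF mem(2,3)] by blast
    have "\<forall>q \<in> Q. \<forall>s \<in> S. transition C ((\<tau> \<circ> \<sigma>) q, s) = (\<tau> \<circ> \<sigma>) (transition A (q, s)) \<and>
        exit_fun C ((\<tau> \<circ> \<sigma>) q, s) = exit_fun A (q, s)"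
      using \<sigma> \<tau> by (simp add: permutes_in_image)
    then show "agree_up_to_states A C"
      using agree_up_to_states_iff[OF mem(1,3)] permutes_compose[OF \<sigma>(1) \<tau>(1)] by blast
  qed
qed auto

text \<open>A renaming carries runs to runs with the same exit words. The appended words can
  therefore be kept, and only the starting state is moved by \<open>\<sigma>\<close>. Local
  interaction becomes a property of whole classes.\<close>

lemma locally_interacting_agree:
  assumes A: "A \<in> mealy_automata Q S" and B: "B \<in> mealy_automata Q S"
    and AB: "agree_up_to_states A B" and li: "locally_interacting A V"
  shows "locally_interacting B V"
proof -
  obtain \<sigma> where \<sigma>: "\<sigma> permutes Q" and eq: "\<And>q s. q \<in> Q \<Longrightarrow> s \<in> S \<Longrightarrow>
      transition B (\<sigma> q, s) = \<sigma> (transition A (q, s)) \<and> exit_fun B (\<sigma> q, s) = exit_fun A (q, s)"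
    using AB agree_up_to_states_iff[OF A B] by blast
  have tw: "transition_word B (\<sigma> q) w = \<sigma> (transition_word A q w)"
    if "q \<in> Q" "w \<in> lists S" for q w
    using that by (induction w arbitrary: q) (auto simp: eq transition_in_states[OF A])
  have ew: "exit_word B (\<sigma> q) w = exit_word A q w" if "q \<in> Q" "w \<in> lists S" for q w
    using that by (induction w arbitrary: q) (auto simp: eq transition_in_states[OF A])
  note [simp] = states_letters[OF A] states_letters[OF B]
  have V: "V \<subseteq> S" using li by (simp add: locally_interacting_def)
  show ?thesis
    unfolding locally_interacting_def
  proof (intro conjI ballI)
    show "V \<subseteq> letters B" using V B by simp
    fix s1 s2 assume s12: "s1 \<in> lists (letters B)" "s2 \<in> lists (letters B)"
    then obtain s s' q where s: "s \<in> lists V" "s' \<in> lists V" "q \<in> Q" "length (s1 @ s) = length (s2 @ s')"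
      "\<forall>s3 \<in> lists S. exit_word A (transition_word A q (s1 @ s)) s3 = exit_word A (transition_word A q (s2 @ s')) s3"
      using li A B unfolding locally_interacting_def by simp blast
    have w: "s1 @ s \<in> lists S" "s2 @ s' \<in> lists S" using s12 s(1,2) V B by auto
    have "\<forall>s3 \<in> lists S. exit_word B (transition_word B (\<sigma> q) (s1 @ s)) s3 =
        exit_word B (transition_word B (\<sigma> q) (s2 @ s')) s3"
    proof
      fix s3 assume "s3 \<in> lists S"
      then show "exit_word B (transition_word B (\<sigma> q) (s1 @ s)) s3 =
          exit_word B (transition_word B (\<sigma> q) (s2 @ s')) s3"
        using s(3,5) w tw[of q "s1 @ s"] tw[of q "s2 @ s'"] ew transition_word_in_states[OF A s(3)]
        by simp
    qed
    moreover have "\<sigma> q \<in> Q" using \<sigma> s(3) by (simp add: permutes_in_image)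
    ultimately show "\<exists>s \<in> lists V. \<exists>s' \<in> lists V. \<exists>q \<in> states B. length (s1 @ s) = length (s2 @ s') \<and>
        (\<forall>s3 \<in> lists (letters B). exit_word B (transition_word B q (s1 @ s)) s3 =
          exit_word B (transition_word B q (s2 @ s')) s3)"
      using s(1,2,4) B by (intro bexI[of _ s] bexI[of _ s'] bexI[of _ "\<sigma> q"]) auto
  qed
qed

section \<open>Local interaction\<close>

text \<open>The power \<open>replicate n v\<close> is a reset word: after it the past is forgotten,
  so two padded words of equal length end in the same state \<open>c\<close>.\<close>

lemma locally_interacting_if_synchronizing:
  assumes A: "A \<in> mealy_automata Q S" and v: "v \<in> S"
    and sync: "\<And>q. q \<in> Q \<Longrightarrow> transition_word A q (replicate n v) = c"
  shows "locally_interacting A {v}"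
  unfolding locally_interacting_def
proof (intro conjI ballI)
  note [simp] = states_letters[OF A]
  show "{v} \<subseteq> letters A" using v by simp
  fix s1 s2 assume s12: "s1 \<in> lists (letters A)" "s2 \<in> lists (letters A)"
  obtain q where q: "q \<in> Q" using A by (auto simp: mealy_automata_def)
  have c: "transition_word A q (u @ replicate (k + n) v) = c" if "u \<in> lists S" for u k
  proof -
    have "transition_word A q (u @ replicate k v) \<in> Q"
      using that v by (intro transition_word_in_states[OF A q]) auto
    then show ?thesis using sync by (simp add: replicate_add transition_word_append)
  qed
  show "\<exists>s \<in> lists {v}. \<exists>s' \<in> lists {v}. \<exists>q \<in> states A. length (s1 @ s) = length (s2 @ s') \<and>
      (\<forall>s3 \<in> lists (letters A). exit_word A (transition_word A q (s1 @ s)) s3 =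
        exit_word A (transition_word A q (s2 @ s')) s3)"
    using A s12 q c
    \<comment> \<open>Each word is padded by the length of the other one plus \<open>n\<close>: the
      totals agree and at least \<open>n\<close> copies of \<open>v\<close> stand at the
      end.\<close>
    by (intro bexI[of _ "replicate (length s2 + n) v"] bexI[of _ "replicate (length s1 + n) v"] bexI[of _ q])
      auto
qed

text \<open>
  If \<open>v\<close> acts injectively on its own image, two states that it does not identify at once stay apart forever.
\<close>
lemma not_locally_interacting:
  assumes A: "A \<in> mealy_automata Q S" and min: "minimal A"
    and inj: "inj_on (\<lambda>q. transition A (q, v)) ((\<lambda>q. transition A (q, v)) ` Q)"
    and words: "s1 \<in> lists S" "s2 \<in> lists S" "length s1 = length s2"
    and apart: "\<And>q. q \<in> Q \<Longrightarrow>
      transition_word A q (s1 @ [v]) \<noteq> transition_word A q (s2 @ [v])"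
  shows "\<not> locally_interacting A {v}"
proof
  note [simp] = states_letters[OF A]
  assume li: "locally_interacting A {v}"
  then have v: "v \<in> S" using A by (simp add: locally_interacting_def)
  obtain s s' q where s: "s \<in> lists {v}" "s' \<in> lists {v}" and q: "q \<in> Q"
    and len: "length (s1 @ s) = length (s2 @ s')"
    and eq: "\<forall>s3 \<in> lists S. exit_word A (transition_word A q (s1 @ s)) s3 = exit_word A (transition_word A q (s2 @ s')) s3"
    using li words(1,2) A unfolding locally_interacting_def by simp blast
  \<comment> \<open>Since \<open>s1\<close> and \<open>s2\<close> have equal length, so do the
    paddings, which use the single letter \<open>v\<close>.\<close>
  obtain n where n: "s = replicate n v" "s' = replicate n v"
    using s len words(3) by (metis append_same_eq length_append add_left_cancel in_listsD replicate_eqI singletonD)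
  \<comment> \<open>The extra final \<open>v\<close> puts both states into the image of
    \<open>v\<close>, where \<open>v\<close> is injective; this is what the induction needs.\<close>
  have "transition_word A q (s1 @ replicate m v @ [v]) \<noteq> transition_word A q (s2 @ replicate m v @ [v])" for m
  proof (induction m)
    case 0 then show ?case using apart[OF q] by simp
  next
    case (Suc m)
    have "transition_word A q (u @ replicate m v @ [v]) \<in> (\<lambda>q. transition A (q, v)) ` Q"
      if "u \<in> lists S" for u
    proof -
      have "transition_word A q (u @ replicate m v) \<in> Q"
        using that v by (intro transition_word_in_states[OF A q]) auto
      then show ?thesis by (simp add: transition_word_append)
    qed
    from inj_onD[OF inj _ this this] Suc.IH words(1,2)
    show ?case by (auto simp: transition_word_append simp flip: replicate_append_same)
  qed
  \<comment> \<open>States that differ after one more \<open>v\<close> already differ before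
    it.\<close>
  then have "transition_word A q (s1 @ s) \<noteq> transition_word A q (s2 @ s')"
    using n by (metis append_assoc transition_word_append)
  moreover have "transition_word A q (s1 @ s) \<in> Q" "transition_word A q (s2 @ s') \<in> Q"
    using words s v by (auto intro!: transition_word_in_states[OF A q])
  ultimately show False using min eq A unfolding minimal_def by auto
qed


section \<open>Automata with three states and two letters as tables\<close>

definition entry :: "('a \<times> 'b) list \<Rightarrow> nat \<Rightarrow> nat \<Rightarrow> 'a \<times> 'b" where
  "entry p q s = p ! (q + q + s)"

text \<open>State by state, the order in which MA-[m,n,k,l] lists its digits; \<open>entry\<close>
  indexes by the same order.\<close>

definition args :: "(nat \<times> nat) list" where
  "args = [(0, 0), (0, 1), (1, 0), (1, 1), (2, 0), (2, 1)]"

definition table :: "(nat, nat) mealy \<Rightarrow> (nat \<times> nat) list" where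
  "table A = map (\<lambda>x. (transition A x, exit_fun A x)) args"

text \<open>Restriction makes both functions extensional, so that this is an inverse of
  \<open>table\<close> and not merely an inverse on the relevant arguments.\<close>

definition automaton :: "(nat \<times> nat) list \<Rightarrow> (nat, nat) mealy" where
  "automaton p = \<lparr>states = {0, 1, 2}, letters = {0, 1},
     transition = restrict (\<lambda>(q, s). fst (entry p q s)) ({0, 1, 2} \<times> {0, 1}),
     exit_fun = restrict (\<lambda>(q, s). snd (entry p q s)) ({0, 1, 2} \<times> {0, 1})\<rparr>"

definition tables :: "(nat \<times> nat) list list" where
  "tables = permutations_of_set_list args"

lemma set_args: "set args = {0, 1, 2} \<times> {0, 1}"
  by (auto simp: args_def)

lemma distinct_args: "distinct args"
  by (simp add: args_def)

lemma distinct_tables: "distinct tables"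
  by (simp add: tables_def distinct_permutations_of_set_list distinct_args)

lemma set_tables: "set tables = permutations_of_set ({0, 1, 2} \<times> {0, 1})"
  using permutations_of_list[of args] by (simp add: tables_def set_args distinct_args distinct_remdups_id)

lemma entry_table:
  assumes "q \<in> {0, 1, 2}" "s \<in> {0, 1}"
  shows "entry (table A) q s = (transition A (q, s), exit_fun A (q, s))"
  using assms by (auto simp: entry_def table_def args_def)

lemma automaton_in_mealy_automata:
  assumes "length p = 6" "set p \<subseteq> {0, 1, 2} \<times> {0, 1}"
  shows "automaton p \<in> mealy_automata {0, 1, 2} {0, 1}"
proof -
  have e: "entry p q s \<in> {0, 1, 2} \<times> {0, 1}" if "q \<in> {0, 1, 2}" "s \<in> {0, 1}" for q s
  proof -
    have "q + q + s < length p" using that assms(1) by auto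
    then show ?thesis using assms(2) nth_mem unfolding entry_def by blast
  qed
  have "fst (entry p q s) \<in> {0, 1, 2}" "snd (entry p q s) \<in> {0, 1}"
    if "q \<in> {0, 1, 2}" "s \<in> {0, 1}" for q s
    using e[OF that] unfolding mem_Times_iff by (rule conjunct1, rule conjunct2)
  then show ?thesis
    unfolding mealy_automata_def automaton_def
    by (simp only: mem_Collect_eq mealy.simps restrict_PiE_iff split_beta insert_not_empty simp_thms)
      (intro conjI ballI; simp only: mem_Times_iff simp_thms)
qed

lemma table_automaton:
  assumes "length p = 6"
  shows "table (automaton p) = p"
proof -
  obtain a b c d e f where "p = [a, b, c, d, e, f]"
    using assms by (auto simp: length_Suc_conv numeral_eq_Suc)
  then show ?thesis by (simp add: table_def automaton_def args_def entry_def)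
qed

lemma length_table: "length (table A) = 6"
  by (simp add: table_def args_def)

lemma set_table:
  assumes A: "A \<in> mealy_automata {0, 1, 2} {0, 1}"
  shows "set (table A) \<subseteq> {0, 1, 2} \<times> {0, 1}"
proof
  fix x assume "x \<in> set (table A)"
  then obtain q s where qs: "q \<in> {0, 1, 2}" "s \<in> {0, 1}"
    and x: "x = (transition A (q, s), exit_fun A (q, s))"
    unfolding table_def set_map set_args by blast
  show "x \<in> {0, 1, 2} \<times> {0, 1}"
    unfolding x mem_Times_iff fst_conv snd_conv
    using transition_in_states[OF A qs] exit_in_letters[OF A qs] ..
qed

lemma automaton_table:
  assumes A: "A \<in> mealy_automata {0, 1, 2} {0, 1}"
  shows "automaton (table A) = A"
proof (rule mealy_eqI[OF _ A])
  show "automaton (table A) \<in> mealy_automata {0, 1, 2} {0, 1}"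
    by (rule automaton_in_mealy_automata[OF length_table set_table[OF A]])
qed (auto simp: automaton_def entry_table)

text \<open>Surjectivity says that the listed images exhaust the pairs, injectivity that the list
  has no repetition.\<close>

lemma bijective_iff_table:
  assumes A: "A \<in> mealy_automata {0, 1, 2} {0, 1}"
  shows "bijective A \<longleftrightarrow> table A \<in> set tables"
proof -
  have "(\<lambda>(q, s). (transition A (q, s), exit_fun A (q, s))) = (\<lambda>x. (transition A x, exit_fun A x))"
    by auto
  then have "bijective A \<longleftrightarrow>
      bij_betw (\<lambda>x. (transition A x, exit_fun A x)) ({0, 1, 2} \<times> {0, 1}) ({0, 1, 2} \<times> {0, 1})"
    unfolding bijective_def states_letters[OF A] by simp
  also have "\<dots> \<longleftrightarrow> table A \<in> permutations_of_set ({0, 1, 2} \<times> {0, 1})"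
    unfolding bij_betw_def permutations_of_set_def table_def
    by (simp only: mem_Collect_eq set_map set_args distinct_map distinct_args simp_thms conj_commute)
  finally show ?thesis unfolding set_tables .
qed

lemma automaton_of_tables:
  assumes "p \<in> set tables"
  shows "automaton p \<in> mealy_automata {0, 1, 2} {0, 1}" "table (automaton p) = p"
proof -
  have "set p = {0, 1, 2} \<times> {0, 1}" "length p = 6"
    using assms length_finite_permutations_of_set[of p]
    by (auto simp: set_tables permutations_of_set_def card_cartesian_product)
  then show "automaton p \<in> mealy_automata {0, 1, 2} {0, 1}" "table (automaton p) = p"
    using automaton_in_mealy_automata table_automaton by simp_all
qed

text \<open>As \<open>table\<close> and \<open>automaton\<close> are mutually inverse, a property
  with a test on tables can be counted by filtering the orderings.\<close>

lemma bij_betw_table: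
  assumes "\<And>A. A \<in> mealy_automata {0, 1, 2} {0, 1} \<Longrightarrow> P A \<longleftrightarrow> P' (table A)"
  shows "bij_betw table {A \<in> mealy_automata {0, 1, 2} {0, 1}. bijective A \<and> P A} (set (filter P' tables))"
proof (rule bij_betw_byWitness[where f' = automaton])
  show "\<forall>A \<in> {A \<in> mealy_automata {0, 1, 2} {0, 1}. bijective A \<and> P A}. automaton (table A) = A"
    using automaton_table by blast
  show "\<forall>p \<in> set (filter P' tables). table (automaton p) = p"
    using automaton_of_tables by simp
  show "table ` {A \<in> mealy_automata {0, 1, 2} {0, 1}. bijective A \<and> P A} \<subseteq> set (filter P' tables)"
  proof (intro image_subsetI)
    fix A assume "A \<in> {A \<in> mealy_automata {0, 1, 2} {0, 1}. bijective A \<and> P A}"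
    then have A: "A \<in> mealy_automata {0, 1, 2} {0, 1}" "bijective A" "P A" by simp_all
    show "table A \<in> set (filter P' tables)"
      using bijective_iff_table[OF A(1)] assms[OF A(1)] A(2,3) by simp
  qed
  show "automaton ` set (filter P' tables) \<subseteq> {A \<in> mealy_automata {0, 1, 2} {0, 1}. bijective A \<and> P A}"
  proof (intro image_subsetI)
    fix q assume "q \<in> set (filter P' tables)"
    then show "automaton q \<in> {A \<in> mealy_automata {0, 1, 2} {0, 1}. bijective A \<and> P A}"
      using automaton_of_tables[of q] bijective_iff_table[of "automaton q"] assms[of "automaton q"] by simp
  qed
qed

lemma card_bijective_automata:
  assumes "\<And>A. A \<in> mealy_automata {0, 1, 2} {0, 1} \<Longrightarrow> P A \<longleftrightarrow> P' (table A)"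
  shows "card {A \<in> mealy_automata {0, 1, 2} {0, 1}. bijective A \<and> P A} = length (filter P' tables)"
  using bij_betw_same_card[OF bij_betw_table[of P P', OF assms]]
  by (simp only: distinct_card distinct_filter distinct_tables)

text \<open>
  In contrast to \<^const>\<open>list_all\<close>, evaluation by the simplifier stops at the first counterexample.
\<close>
primrec forall :: "('a \<Rightarrow> bool) \<Rightarrow> 'a list \<Rightarrow> bool" where
  "forall P [] \<longleftrightarrow> True"
| "forall P (x # xs) \<longleftrightarrow> (if P x then forall P xs else False)"

lemma forall_iff: "forall P xs \<longleftrightarrow> (\<forall>x \<in> set xs. P x)"
  by (induction xs) auto

text \<open>The 27 self-maps of the state set as lists of values. They serve as potentials, as maps
  whose kernels are congruences, and as renamings.\<close>

definition maps :: "nat list list" where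
  "maps = List.n_lists 3 [0, 1, 2]"

lemma nth_maps_in:
  assumes "c \<in> set maps" "q \<in> {0, 1, 2}"
  shows "c ! q \<in> {0, 1, 2}"
proof -
  have c: "length c = 3" "set c \<subseteq> {0, 1, 2}"
    using assms(1) by (auto simp: maps_def set_n_lists)
  have "q < length c" using c(1) assms(2) by auto
  then show ?thesis using c(2) nth_mem by blast
qed

text \<open>A list \<open>c\<close> fixes \<open>(!) c\<close> meaningfully only below its length;
  the assumption that \<open>P\<close> looks at the values on the states alone bridges lists and
  functions.\<close>

lemma maps_iff: "(\<exists>c \<in> set maps. P ((!) c)) \<longleftrightarrow> (\<exists>c \<in> {0, 1, 2} \<rightarrow> {0, 1, 2}. P c)"
  if cong: "\<And>c d. (\<And>q. q \<in> {0, 1, 2} \<Longrightarrow> c q = d q) \<Longrightarrow> P c = P d" for P :: "(nat \<Rightarrow> nat) \<Rightarrow> bool"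
proof
  assume "\<exists>c \<in> set maps. P ((!) c)"
  then obtain c where c: "c \<in> set maps" "P ((!) c)" ..
  show "\<exists>c \<in> {0, 1, 2} \<rightarrow> {0, 1, 2}. P c"
    using c(2) nth_maps_in[OF c(1)] by (intro bexI[of _ "(!) c"] Pi_I)
next
  assume "\<exists>c \<in> {0, 1, 2} \<rightarrow> {0, 1, 2}. P c"
  then obtain c where c: "c \<in> {0, 1, 2} \<rightarrow> {0, 1, 2}" "P c" by blast
  have "map c [0, 1, 2] \<in> set maps"
    using c(1) by (auto simp: maps_def set_n_lists)
  moreover have "P ((!) (map c [0, 1, 2]))"
    using c(2) by (subst cong[of _ c]) auto
  ultimately show "\<exists>c \<in> set maps. P ((!) c)" by blast
qed

lemma distinct_iff_inj_on:
  assumes "c \<in> set maps"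
  shows "distinct c \<longleftrightarrow> inj_on ((!) c) {0, 1, 2}"
proof -
  have "length c = 3" using assms by (simp add: maps_def set_n_lists)
  moreover have "{..<3} = {0, 1, 2 :: nat}" by auto
  ultimately show ?thesis by (metis distinct_conv_nth inj_on_nth lessThan_iff inj_on_def)
qed

section \<open>Tests of the properties on tables\<close>

definition closed_table :: "(nat \<times> nat) list \<Rightarrow> nat list \<Rightarrow> bool" where
  "closed_table p U \<longleftrightarrow> forall (\<lambda>(q, s). if q \<in> set U then fst (entry p q s) \<in> set U else True) args"

text \<open>The listed sets are all non-empty proper subsets of the states.\<close>

definition transitive_table :: "(nat \<times> nat) list \<Rightarrow> bool" where
  "transitive_table p \<longleftrightarrow>
     forall (\<lambda>U. \<not> closed_table p U) [[0], [1], [2], [0, 1], [0, 2], [1, 2]]"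

lemma transitive_iff_table:
  assumes A: "A \<in> mealy_automata {0, 1, 2} {0, 1}"
  shows "transitive A \<longleftrightarrow> transitive_table (table A)"
proof -
  define closed where "closed U \<longleftrightarrow> (\<forall>q \<in> U. \<forall>s \<in> {0, 1}. transition A (q, s) \<in> U)" for U
  have closed: "closed_table (table A) U \<longleftrightarrow> closed (set U)" if "set U \<subseteq> {0, 1, 2}" for U
    using that unfolding closed_table_def forall_iff set_args closed_def by (auto simp: entry_table)
  have Pow: "Pow {0, 1, 2} = {{}, {0}, {1}, {2}, {0, 1}, {0, 2}, {1, 2}, {0, 1, 2 :: nat}}"
    unfolding Pow_insert Pow_empty by (simp add: insert_commute)
  have "transitive A \<longleftrightarrow> (\<forall>U \<in> Pow {0, 1, 2}. U \<noteq> {} \<longrightarrow> closed U \<longrightarrow> U = {0, 1, 2})"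
    unfolding transitive_iff_closed_subsets[OF A] closed_def by (simp only: Ball_def Pow_iff)
  also have "\<dots> \<longleftrightarrow>
      \<not> closed {0} \<and> \<not> closed {1} \<and> \<not> closed {2} \<and> \<not> closed {0, 1} \<and> \<not> closed {0, 2} \<and> \<not> closed {1, 2}"
  proof -
    have "U \<noteq> {0, 1, 2}" if "0 \<notin> U \<or> 1 \<notin> U \<or> 2 \<notin> U" for U :: "nat set"
      using that by blast
    then show ?thesis unfolding Pow by simp
  qed
  finally show ?thesis
    unfolding transitive_table_def forall_iff[of _ "[[0], [1], [2], [0, 1], [0, 2], [1, 2]]"]
    by (simp add: closed)
qed

text \<open>The two negations around \<open>forall\<close> express the existence of a
  potential.\<close>

definition particle_preserving_table :: "(nat \<times> nat) list \<Rightarrow> bool" where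
  "particle_preserving_table p \<longleftrightarrow>
     \<not> forall (\<lambda>h. \<not> forall (\<lambda>(q, s). case entry p q s of (q', s') \<Rightarrow> h ! q + s = h ! q' + s') args) maps"

lemma particle_preserving_iff_table:
  assumes A: "A \<in> mealy_automata {0, 1, 2} {0, 1}"
  shows "particle_preserving A \<longleftrightarrow> particle_preserving_table (table A)"
proof -
  define potential where "potential h \<longleftrightarrow> (\<forall>q \<in> {0, 1, 2}. \<forall>s \<in> {0, 1}.
      h q + s = h (transition A (q, s)) + exit_fun A (q, s))" for h
  have "forall (\<lambda>(q, s). case entry (table A) q s of (q', s') \<Rightarrow> h ! q + s = h ! q' + s') args
      \<longleftrightarrow> potential ((!) h)" for h
    unfolding forall_iff set_args potential_def by (auto simp: entry_table)
  then have "particle_preserving_table (table A) \<longleftrightarrow> (\<exists>h \<in> set maps. potential ((!) h))"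
    unfolding particle_preserving_table_def by (simp add: forall_iff[of _ maps])
  also have "\<dots> \<longleftrightarrow> (\<exists>h \<in> {0, 1, 2} \<rightarrow> {0, 1, 2}. potential h)"
    using transition_in_states[OF A] by (intro maps_iff) (simp add: potential_def)
  finally have "particle_preserving_table (table A) \<longleftrightarrow> (\<exists>h \<in> {0, 1, 2} \<rightarrow> {0, 1, 2}. potential h)" .
  moreover have "{..<card {0, 1, 2 :: nat}} = {0, 1, 2}" by auto
  ultimately show ?thesis
    using particle_preserving_iff_potential[OF A] unfolding potential_def by simp
qed

definition minimal_table :: "(nat \<times> nat) list \<Rightarrow> bool" where
  "minimal_table p \<longleftrightarrow>
     forall (\<lambda>c. if distinct c then True else
        \<not> forall (\<lambda>((q, r), s). if c ! q = c ! r then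
             (case entry p q s of (q', s') \<Rightarrow> case entry p r s of (r', t') \<Rightarrow> s' = t' \<and> c ! q' = c ! r') else True)
           (List.product (List.product [0, 1, 2] [0, 1, 2]) [0, 1])) maps"

lemma minimal_iff_table:
  assumes A: "A \<in> mealy_automata {0, 1, 2} {0, 1}"
  shows "minimal A \<longleftrightarrow> minimal_table (table A)"
proof -
  define congruence where "congruence c \<longleftrightarrow> (\<forall>q \<in> {0, 1, 2}. \<forall>r \<in> {0, 1, 2}. c q = c r \<longrightarrow>
      (\<forall>s \<in> {0, 1}. exit_fun A (q, s) = exit_fun A (r, s) \<and> c (transition A (q, s)) = c (transition A (r, s))))"
    for c :: "nat \<Rightarrow> nat"
  have c: "forall (\<lambda>((q, r), s). if c ! q = c ! r then
             (case entry (table A) q s of (q', s') \<Rightarrow> case entry (table A) r s of (r', t') \<Rightarrow> s' = t' \<and> c ! q' = c ! r') else True)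
           (List.product (List.product [0, 1, 2] [0, 1, 2]) [0, 1]) \<longleftrightarrow> congruence ((!) c)" for c
    unfolding forall_iff congruence_def set_product by (simp add: entry_table)
  \<comment> \<open>The negated form is existential, which is the shape \<open>maps_iff\<close>
    transfers.\<close>
  have "\<not> minimal_table (table A) \<longleftrightarrow> (\<exists>c \<in> set maps. congruence ((!) c) \<and> \<not> inj_on ((!) c) {0, 1, 2})"
    unfolding minimal_table_def c unfolding forall_iff by (auto simp: distinct_iff_inj_on)
  also have "\<dots> \<longleftrightarrow> (\<exists>c \<in> {0, 1, 2} \<rightarrow> {0, 1, 2}. congruence c \<and> \<not> inj_on c {0, 1, 2})"
    using transition_in_states[OF A] by (intro maps_iff) (simp add: congruence_def inj_on_def)
  finally show ?thesis
    unfolding minimal_iff_no_congruence[OF A] congruence_def by blast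
qed

definition agree_table :: "(nat \<times> nat) list \<Rightarrow> (nat \<times> nat) list \<Rightarrow> bool" where
  "agree_table p r \<longleftrightarrow>
     \<not> forall (\<lambda>\<sigma>. if distinct \<sigma> then
        \<not> forall (\<lambda>(q, s). case entry p q s of (q', s') \<Rightarrow> entry r (\<sigma> ! q) s = (\<sigma> ! q', s')) args
        else True) maps"

lemma agree_up_to_states_iff_table:
  assumes A: "A \<in> mealy_automata {0, 1, 2} {0, 1}" and B: "B \<in> mealy_automata {0, 1, 2} {0, 1}"
  shows "agree_up_to_states A B \<longleftrightarrow> agree_table (table A) (table B)"
proof -
  define renaming where "renaming \<sigma> \<longleftrightarrow> (\<forall>q \<in> {0, 1, 2}. \<forall>s \<in> {0, 1}.
      transition B (\<sigma> q, s) = \<sigma> (transition A (q, s)) \<and> exit_fun B (\<sigma> q, s) = exit_fun A (q, s))" for \<sigma>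
  have \<sigma>: "forall (\<lambda>(q, s). case entry (table A) q s of (q', s') \<Rightarrow> entry (table B) (\<sigma> ! q) s = (\<sigma> ! q', s')) args
      \<longleftrightarrow> renaming ((!) \<sigma>)" if "\<sigma> \<in> set maps" for \<sigma>
    unfolding forall_iff set_args renaming_def using nth_maps_in[OF that] by (simp add: entry_table)
  have "agree_table (table A) (table B) \<longleftrightarrow> (\<exists>\<sigma> \<in> set maps. inj_on ((!) \<sigma>) {0, 1, 2} \<and> renaming ((!) \<sigma>))"
    unfolding agree_table_def forall_iff[of _ maps] by (auto simp: distinct_iff_inj_on \<sigma>)
  also have "\<dots> \<longleftrightarrow> (\<exists>\<sigma> \<in> {0, 1, 2} \<rightarrow> {0, 1, 2}. inj_on \<sigma> {0, 1, 2} \<and> renaming \<sigma>)"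
    using transition_in_states[OF A] by (intro maps_iff) (simp add: renaming_def inj_on_def)
  finally show ?thesis
    using agree_up_to_states_iff_inj_on[OF A B] by (simp add: renaming_def)
qed

section \<open>The enumeration\<close>

text \<open>Uniqueness of digits for Horner's scheme. With arbitrary starting values the induction
  can begin at the leading digit: the hypothesis gives \<open>m * a + x = m * b + y\<close>, and
  division by \<open>m\<close> with remainder separates accumulator and digit.\<close>

lemma foldl_digits_inject:
  fixes m :: nat
  assumes "length xs = length ys" "\<forall>x \<in> set xs. x < m" "\<forall>y \<in> set ys. y < m"
    and "foldl (\<lambda>k d. m * k + d) a xs = foldl (\<lambda>k d. m * k + d) b ys"
  shows "a = b \<and> xs = ys"
  using assms
proof (induction xs ys arbitrary: a b rule: list_induct2)
  case (Cons x xs y ys)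
  have eq: "m * a + x = m * b + y \<and> xs = ys"
    using Cons.prems by (intro Cons.IH) simp_all
  have "x < m" "y < m" using Cons.prems by simp_all
  then have "(m * a + x) div m = a" "(m * b + y) div m = b" "(m * a + x) mod m = x" "(m * b + y) mod m = y"
    by simp_all
  then show ?case using eq by metis
qed simp

text \<open>Resolves the definite description: \<open>automaton p\<close> has the required digits,
  and uniqueness of digits leaves no other automaton.\<close>

lemma MA_eq_automaton:
  assumes p: "length p = 6" "set p \<subseteq> {0, 1, 2} \<times> {0, 1}"
    and k: "k = foldl (\<lambda>k d. 3 * k + d) 0 (map fst p)" and l: "l = foldl (\<lambda>l d. 2 * l + d) 0 (map snd p)"
  shows "MA 3 2 k l = automaton p"
proof -
  have sets: "{..<3} = {0, 1, 2 :: nat}" "{..<2} = {0, 1 :: nat}" by auto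
  \<comment> \<open>Along \<open>args\<close> the exponents run from 5 down to 0, so the double sums
    are Horner evaluations.\<close>
  have sum3: "(\<Sum>i<3. \<Sum>j<2. f (i, j) * 3 ^ (3 * 2 - i * 2 - j - 1)) = foldl (\<lambda>k d. 3 * k + d) 0 (map f args)"
    and sum2: "(\<Sum>i<3. \<Sum>j<2. f (i, j) * 2 ^ (3 * 2 - i * 2 - j - 1)) = foldl (\<lambda>k d. 2 * k + d) 0 (map f args)"
    for f :: "nat \<times> nat \<Rightarrow> nat"
    by (simp_all add: sets args_def add_mult_distrib2)
  have fst: "map (transition A) args = map fst (table A)" and snd: "map (exit_fun A) args = map snd (table A)" for A
    by (simp_all add: table_def)
  show ?thesis
    unfolding MA_def sum3 sum2 unfolding sets fst snd
  proof (rule the_equality)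
    show "automaton p \<in> mealy_automata {0, 1, 2} {0, 1} \<and>
        k = foldl (\<lambda>k d. 3 * k + d) 0 (map fst (table (automaton p))) \<and>
        l = foldl (\<lambda>k d. 2 * k + d) 0 (map snd (table (automaton p)))"
      using automaton_in_mealy_automata[OF p] table_automaton[OF p(1)] k l by simp
  next
    fix A assume A: "A \<in> mealy_automata {0, 1, 2} {0, 1} \<and>
        k = foldl (\<lambda>k d. 3 * k + d) 0 (map fst (table A)) \<and>
        l = foldl (\<lambda>k d. 2 * k + d) 0 (map snd (table A))"
    have len: "length (table A) = length p" using p(1) by (simp add: length_table)
    have "\<forall>x \<in> {0, 1, 2} \<times> {0, 1}. fst x < (3 :: nat) \<and> snd x < (2 :: nat)" by auto
    then have lt: "fst x < 3" "snd x < 2" if "x \<in> set (table A) \<or> x \<in> set p" for x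
      using that p(2) set_table A by blast+
    have "map fst (table A) = map fst p"
      by (rule conjunct2[OF foldl_digits_inject[of _ _ 3 0 0]]) (use A k len lt in simp_all)
    moreover have "map snd (table A) = map snd p"
      by (rule conjunct2[OF foldl_digits_inject[of _ _ 2 0 0]]) (use A l len lt in simp_all)
    ultimately have "table A = p" using len by (metis zip_map_fst_snd)
    then show "A = automaton p" using A automaton_table by metis
  qed
qed

definition synchronizing_tables :: "(nat \<times> nat) list list" where
  "synchronizing_tables =
    [[(0, 0), (1, 0), (0, 1), (2, 0), (1, 1), (2, 1)],
     [(0, 0), (1, 0), (2, 0), (1, 1), (0, 1), (2, 1)],
     [(0, 0), (1, 0), (2, 0), (2, 1), (0, 1), (1, 1)]]"

text \<open>The tables of MA-[3,2,128,19], MA-[3,2,318,52], MA-[3,2,106,13] and MA-[3,2,266,19]. The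
  image of the letter 0 has two states; 0 fixes both in the first and third table and swaps them in
  the second and fourth.\<close>

definition oscillating_tables :: "(nat \<times> nat) list list" where
  "oscillating_tables =
    [[(0, 0), (1, 1), (1, 0), (2, 0), (0, 1), (2, 1)],
     [(1, 1), (0, 1), (2, 0), (2, 1), (1, 0), (0, 0)],
     [(0, 0), (1, 0), (0, 1), (2, 1), (2, 0), (1, 1)],
     [(1, 0), (0, 1), (0, 0), (2, 0), (1, 1), (2, 1)]]"

definition rep_tables :: "(nat \<times> nat) list list" where
  "rep_tables = synchronizing_tables @ oscillating_tables"

lemma enumeration_transitive: "length (filter transitive_table tables) = 592"
  by code_simp

text \<open>The filters are nested, so the later tests run only on survivors of the earlier ones.
  The last conjunct is exhaustiveness: each of the 42 tables is a renaming of a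
  representative.\<close>

lemma enumeration_particle_preserving:
  "let P = filter particle_preserving_table tables;
       T = filter transitive_table P;
       M = filter minimal_table T
   in length P = 84 \<and> length T = 68 \<and> length M = 42 \<and>
     forall (\<lambda>p. \<not> forall (\<lambda>r. \<not> agree_table r p) rep_tables) M"
  by code_simp

lemma rep_tables_permutations:
  "forall (\<lambda>r. set r = set args \<and> distinct r) rep_tables"
  by code_simp

lemma rep_tables_properties:
  "forall (\<lambda>r. transitive_table r \<and> particle_preserving_table r \<and> minimal_table r) rep_tables"
  by code_simp

text \<open>Together with exhaustiveness this gives exactly seven classes.\<close>

lemma rep_tables_inequivalent:
  "forall (\<lambda>r. forall (\<lambda>r'. if agree_table r r' then r = r' else True) rep_tables) rep_tables"
  by code_simp

lemma MA_synchronizing: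
  "{MA 3 2 104 11, MA 3 2 146 7, MA 3 2 154 7} = automaton ` set synchronizing_tables"
proof -
  have "MA 3 2 104 11 = automaton
      [(0, 0), (1, 0), (0, 1), (2, 0), (1, 1), (2, 1)]"
    by (rule MA_eq_automaton) simp_all
  moreover have "MA 3 2 146 7 = automaton
      [(0, 0), (1, 0), (2, 0), (1, 1), (0, 1), (2, 1)]"
    by (rule MA_eq_automaton) simp_all
  moreover have "MA 3 2 154 7 = automaton
      [(0, 0), (1, 0), (2, 0), (2, 1), (0, 1), (1, 1)]"
    by (rule MA_eq_automaton) simp_all
  ultimately show ?thesis by (simp add: synchronizing_tables_def)
qed

lemma MA_oscillating:
  "{MA 3 2 128 19, MA 3 2 318 52, MA 3 2 106 13, MA 3 2 266 19} = automaton ` set oscillating_tables"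
proof -
  have "MA 3 2 128 19 = automaton
      [(0, 0), (1, 1), (1, 0), (2, 0), (0, 1), (2, 1)]"
    by (rule MA_eq_automaton) simp_all
  moreover have "MA 3 2 318 52 = automaton
      [(1, 1), (0, 1), (2, 0), (2, 1), (1, 0), (0, 0)]"
    by (rule MA_eq_automaton) simp_all
  moreover have "MA 3 2 106 13 = automaton
      [(0, 0), (1, 0), (0, 1), (2, 1), (2, 0), (1, 1)]"
    by (rule MA_eq_automaton) simp_all
  moreover have "MA 3 2 266 19 = automaton
      [(1, 0), (0, 1), (0, 0), (2, 0), (1, 1), (2, 1)]"
    by (rule MA_eq_automaton) simp_all
  ultimately show ?thesis by (simp add: oscillating_tables_def)
qed

lemma rep_tables_in_tables:
  assumes "r \<in> set rep_tables"
  shows "r \<in> set tables"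
proof -
  have "set r = set args" "distinct r"
    using assms rep_tables_permutations unfolding forall_iff by blast+
  then show ?thesis unfolding set_tables set_args by (intro permutations_of_setI)
qed

lemma locally_interacting_synchronizing:
  assumes "r \<in> set synchronizing_tables"
  shows "locally_interacting (automaton r) {0}"
\<comment> \<open>In all three tables the letter 0 fixes state 0 and brings the other states there
  in at most two steps.\<close>
proof (rule locally_interacting_if_synchronizing[where n = 2 and c = 0])
  show "automaton r \<in> mealy_automata {0, 1, 2} {0, 1}"
    using assms by (intro automaton_of_tables rep_tables_in_tables) (simp add: rep_tables_def)
  show "transition_word (automaton r) q (replicate 2 0) = 0" if "q \<in> {0, 1, 2}" for q
    using assms that by (auto simp: synchronizing_tables_def automaton_def entry_def numeral_2_eq_2)
qed simp

text \<open>The letter 0 permutes its image, so separated runs never merge, and minimality turns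
  distinct states into distinct behaviour.\<close>

lemma not_locally_interacting_oscillating:
  assumes r: "r \<in> set oscillating_tables"
  shows "\<not> locally_interacting (automaton r) {0}"
proof -
  have rep: "r \<in> set rep_tables" using r by (simp add: rep_tables_def)
  note A = automaton_of_tables[OF rep_tables_in_tables[OF rep]]
  have "minimal_table r" using rep rep_tables_properties unfolding forall_iff by blast
  then have min: "minimal (automaton r)" using minimal_iff_table[OF A(1)] A(2) by simp
  define t where "t q = transition (automaton r) (q, 0)" for q
  have "\<forall>q \<in> {0, 1, 2}. \<forall>q' \<in> {0, 1, 2}. t (t q) = t (t q') \<longrightarrow> t q = t q'"
    unfolding t_def using r unfolding oscillating_tables_def list.set insert_iff
    by (elim disjE) (simp_all add: automaton_def entry_def)
  then have inj: "inj_on (\<lambda>q. transition (automaton r) (q, 0)) ((\<lambda>q. transition (automaton r) (q, 0)) ` {0, 1, 2})"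
    unfolding t_def[symmetric] inj_on_def by blast
  have "\<exists>s1 s2. s1 \<in> lists {0, 1} \<and> s2 \<in> lists {0, 1} \<and> length s1 = length s2 \<and>
      (\<forall>q \<in> {0, 1, 2}. transition_word (automaton r) q (s1 @ [0]) \<noteq> transition_word (automaton r) q (s2 @ [0]))"
  proof -
    let ?apart = "\<lambda>s1 s2. \<forall>q \<in> {0, 1, 2}.
      transition_word (automaton r) q (s1 @ [0]) \<noteq> transition_word (automaton r) q (s2 @ [0])"
    \<comment> \<open>The first pair works for the first table of \<open>oscillating_tables\<close>,
      the second pair for the second and fourth, the last pair for the third.\<close>
    have "?apart [0, 0] [0, 1] \<or> ?apart [0, 1] [1, 0] \<or> ?apart [1, 0] [1, 1]"
      using r unfolding oscillating_tables_def list.set insert_iff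
      by (elim disjE) (simp_all add: automaton_def entry_def)
    then show ?thesis by (elim disjE) (intro exI conjI; (assumption | simp))+
  qed
  then show ?thesis using not_locally_interacting[OF A(1) min inj] by blast
qed

theorem mainTheorem1:
  shows
    "let All = mealy_automata {0, 1, 2 :: nat} {0, 1 :: nat};
         Bij = {A \<in> All. bijective A};
         TP = {A \<in> Bij. transitive A \<and> particle_preserving A};
         M = {A \<in> TP. minimal A};
         R = {(A, B). A \<in> M \<and> B \<in> M \<and> agree_up_to_states A B};
         Reps = {MA 3 2 104 11, MA 3 2 146 7, MA 3 2 128 19, MA 3 2 154 7,
                 MA 3 2 318 52, MA 3 2 106 13, MA 3 2 266 19};
         LIReps = {MA 3 2 104 11, MA 3 2 146 7, MA 3 2 154 7};
         LI = {C \<in> M // R. \<forall>A \<in> C. locally_interacting A {0}}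
     in card All = 46656
      \<and> card Bij = 720
      \<and> card {A \<in> Bij. transitive A} = 592
      \<and> card {A \<in> Bij. particle_preserving A} = 84
      \<and> card TP = 68
      \<and> card M = 42
      \<and> equiv M R
      \<and> card (M // R) = 7
      \<and> Reps \<subseteq> M
      \<and> M // R = (\<lambda>A. R `` {A}) ` Reps
      \<and> card LI = 3
      \<and> LI = (\<lambda>A. R `` {A}) ` LIReps
      \<and> (\<forall>C \<in> M // R - LI. \<forall>A \<in> C. \<not> locally_interacting A {0})"
proof -
  let ?All = "mealy_automata {0, 1, 2 :: nat} {0, 1 :: nat}"
  let ?Bij = "{A \<in> ?All. bijective A}"
  let ?TP = "{A \<in> ?Bij. transitive A \<and> particle_preserving A}"
  define M where "M = {A \<in> ?TP. minimal A}"
  define R where "R = {(A, B). A \<in> M \<and> B \<in> M \<and> agree_up_to_states A B}"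
  define Reps where "Reps = {MA 3 2 104 11, MA 3 2 146 7, MA 3 2 128 19, MA 3 2 154 7,
                MA 3 2 318 52, MA 3 2 106 13, MA 3 2 266 19}"
  define LIReps where "LIReps = {MA 3 2 104 11, MA 3 2 146 7, MA 3 2 154 7}"
  define LI where "LI = {C \<in> M // R. \<forall>A \<in> C. locally_interacting A {0}}"
  note iff_table = transitive_iff_table particle_preserving_iff_table minimal_iff_table
  let ?Mtab = "filter (\<lambda>p. (particle_preserving_table p \<and> transitive_table p) \<and> minimal_table p) tables"
  have enum: "length (filter particle_preserving_table tables) = 84"
    "length (filter (\<lambda>p. particle_preserving_table p \<and> transitive_table p) tables) = 68"
    "length ?Mtab = 42" "\<forall>p \<in> set ?Mtab. \<exists>r \<in> set rep_tables. agree_table r p"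
    using enumeration_particle_preserving unfolding Let_def filter_filter forall_iff by simp_all

  \<comment> \<open>The counts\<close>
  have card_All: "card ?All = 46656"
  proof -
    have "card {0, 1, 2 :: nat} = 3" "card {0, 1 :: nat} = 2" by simp_all
    then have "card ?All = (3 * 2) ^ (3 * 2)"
      by (subst card_mealy_automata) (simp_all only: finite.intros insert_not_empty not_False_eq_True)
    then show ?thesis by simp
  qed
  \<comment> \<open>The trivial property fits the plain count of bijective automata into the
    counting lemma.\<close>
  have "card {A \<in> ?All. bijective A \<and> True} = length (filter (\<lambda>_. True) tables)"
    by (rule card_bijective_automata) simp
  also have "\<dots> = card (permutations_of_set ({0, 1, 2 :: nat} \<times> {0, 1 :: nat}))"
    using distinct_card[OF distinct_tables] by (simp add: set_tables)
  finally have card_Bij: "card ?Bij = 720"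
    by (simp add: card_cartesian_product fact_numeral)
  have "card {A \<in> ?All. bijective A \<and> transitive A} = length (filter transitive_table tables)"
    by (rule card_bijective_automata) (rule iff_table)
  then have card_T: "card {A \<in> ?Bij. transitive A} = 592"
    by (simp add: enumeration_transitive conj_assoc)
  have "card {A \<in> ?All. bijective A \<and> particle_preserving A} = length (filter particle_preserving_table tables)"
    by (rule card_bijective_automata) (rule iff_table)
  then have card_P: "card {A \<in> ?Bij. particle_preserving A} = 84"
    using enum(1) by (simp add: conj_assoc)
  have "card {A \<in> ?All. bijective A \<and> (transitive A \<and> particle_preserving A)} =
      length (filter (\<lambda>p. particle_preserving_table p \<and> transitive_table p) tables)"
    by (rule card_bijective_automata) (auto simp: iff_table)
  then have card_TP: "card ?TP = 68"
    using enum(2) by (simp add: conj_assoc)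
  have M_eq: "M = {A \<in> ?All. bijective A \<and> transitive A \<and> particle_preserving A \<and> minimal A}"
    unfolding M_def by blast
  have M_All: "M \<subseteq> ?All" unfolding M_def by blast
  have R_iff: "(A, B) \<in> R \<longleftrightarrow> A \<in> M \<and> B \<in> M \<and> agree_up_to_states A B" for A B
    by (simp add: R_def)
  have M_iff: "(transitive A \<and> particle_preserving A \<and> minimal A) \<longleftrightarrow>
      ((particle_preserving_table (table A) \<and> transitive_table (table A)) \<and> minimal_table (table A))"
    if "A \<in> ?All" for A
    using iff_table[OF that] by blast
  have "card {A \<in> ?All. bijective A \<and> transitive A \<and> particle_preserving A \<and> minimal A} = length ?Mtab"
    by (rule card_bijective_automata) (rule M_iff)
  then have card_M: "card M = 42"
    unfolding M_eq enum(3) .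
  have table_M: "table A \<in> set ?Mtab" if "A \<in> M" for A
    using that bijective_iff_table[of A] M_iff[of A] unfolding M_eq by simp

  \<comment> \<open>The seven classes\<close>
  have equiv: "equiv M R"
    unfolding R_def by (rule equiv_agree_up_to_states[OF M_All])
  have Reps: "Reps = automaton ` set rep_tables"
    unfolding Reps_def rep_tables_def set_append image_Un MA_synchronizing[symmetric] MA_oscillating[symmetric]
    by blast
  have rep_M: "automaton r \<in> M" if "r \<in> set rep_tables" for r
  proof -
    note A = automaton_of_tables[OF rep_tables_in_tables[OF that]]
    have "transitive_table r \<and> particle_preserving_table r \<and> minimal_table r"
      using that rep_tables_properties unfolding forall_iff by blast
    then show ?thesis
      using A bijective_iff_table[OF A(1)] M_iff[OF A(1)] rep_tables_in_tables[OF that]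
      unfolding M_eq by simp
  qed
  have Reps_M: "Reps \<subseteq> M"
    unfolding Reps using rep_M by blast
  \<comment> \<open>Exhaustiveness of the enumeration, carried from tables back to automata.\<close>
  have ex_rep: "\<exists>B \<in> Reps. (B, A) \<in> R" if A: "A \<in> M" for A
  proof -
    obtain r where r: "r \<in> set rep_tables" "agree_table r (table A)"
      using bspec[OF enum(4) table_M[OF A]] ..
    note B = automaton_of_tables[OF rep_tables_in_tables[OF r(1)]]
    have "agree_up_to_states (automaton r) A"
      using r(2) agree_up_to_states_iff_table[OF B(1), of A] A M_All B(2) by auto
    then show ?thesis using rep_M[OF r(1)] A r(1) unfolding Reps R_iff by blast
  qed
  have quotient: "M // R = (\<lambda>A. R `` {A}) ` Reps"
  proof (intro equalityI subsetI)
    fix C assume "C \<in> M // R"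
    then obtain A where A: "A \<in> M" "C = R `` {A}" by (rule quotientE)
    then obtain B where B: "B \<in> Reps" "(B, A) \<in> R" using ex_rep by blast
    then show "C \<in> (\<lambda>A. R `` {A}) ` Reps"
      using A(2) equiv_class_eq[OF equiv B(2)] by (intro image_eqI[OF _ B(1)]) simp
  next
    fix C assume "C \<in> (\<lambda>A. R `` {A}) ` Reps"
    then obtain A where A: "C = R `` {A}" "A \<in> Reps" by (rule imageE)
    show "C \<in> M // R" unfolding A(1) by (rule quotientI) (rule subsetD[OF Reps_M A(2)])
  qed
  \<comment> \<open>Equal classes would make two representatives agree, which happens only for equal
    tables.\<close>
  have inj: "inj_on (\<lambda>A. R `` {A}) Reps"
  proof (rule inj_onI)
    fix A B assume AB: "A \<in> Reps" "B \<in> Reps" and eq: "R `` {A} = R `` {B}"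
    obtain r r' where r: "r \<in> set rep_tables" "r' \<in> set rep_tables" "A = automaton r" "B = automaton r'"
      using AB unfolding Reps by blast
    have "(A, B) \<in> R" using eq_equiv_class[OF eq equiv] AB(2) Reps_M by blast
    then have "agree_up_to_states (automaton r) (automaton r')" using r R_iff by blast
    then have "agree_table r r'"
      using automaton_of_tables[OF rep_tables_in_tables[OF r(1)]]
        automaton_of_tables[OF rep_tables_in_tables[OF r(2)]] agree_up_to_states_iff_table by simp
    then have "r = r'" using bspec[OF bspec[OF rep_tables_inequivalent[unfolded forall_iff] r(1)] r(2)] by simp
    then show "A = B" using r by simp
  qed
  have inj_automaton: "inj_on automaton (set rep_tables)"
    by (rule inj_on_inverseI[of _ table]) (rule automaton_of_tables(2)[OF rep_tables_in_tables])
  have card_reps: "card (set rep_tables) = 7" "card (set synchronizing_tables) = 3"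
    by (simp_all add: rep_tables_def synchronizing_tables_def oscillating_tables_def)
  have card_quotient: "card (M // R) = 7"
    unfolding quotient card_image[OF inj] unfolding Reps card_image[OF inj_automaton] by (rule card_reps)

  \<comment> \<open>Local interaction of the classes\<close>
  have LI_class: "locally_interacting A {0}"
    if "(A, B) \<in> R \<or> (B, A) \<in> R" "locally_interacting B {0}" for A B
  proof -
    have "(B, A) \<in> R" using that(1) equiv unfolding equiv_def sym_def by blast
    then have "A \<in> ?All" "B \<in> ?All" "agree_up_to_states B A" using M_All R_iff by blast+
    then show ?thesis using locally_interacting_agree that(2) by blast
  qed
  \<comment> \<open>Every representative is either synchronizing or oscillating, so both directions
    are settled by the two criteria.\<close>
  have LI_rep: "locally_interacting A {0} \<longleftrightarrow> A \<in> LIReps" if "A \<in> Reps" for A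
    using that locally_interacting_synchronizing not_locally_interacting_oscillating
    unfolding Reps LIReps_def MA_synchronizing rep_tables_def by auto
  have LIReps_Reps: "LIReps \<subseteq> Reps" unfolding LIReps_def Reps_def by blast
  have LI: "LI = (\<lambda>A. R `` {A}) ` LIReps"
  proof (intro equalityI subsetI)
    fix C assume C: "C \<in> LI"
    then have "C \<in> (\<lambda>A. R `` {A}) ` Reps" unfolding LI_def quotient by simp
    then obtain A where A: "C = R `` {A}" "A \<in> Reps" by (rule imageE)
    have "A \<in> C" unfolding A(1) by (rule equiv_class_self[OF equiv subsetD[OF Reps_M A(2)]])
    then have "A \<in> LIReps" using LI_rep[OF A(2)] C unfolding LI_def by simp
    then show "C \<in> (\<lambda>A. R `` {A}) ` LIReps" by (rule image_eqI[where f = "\<lambda>A. R `` {A}", OF A(1)])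
  next
    fix C assume "C \<in> (\<lambda>A. R `` {A}) ` LIReps"
    then obtain A where A: "C = R `` {A}" "A \<in> LIReps" by (rule imageE)
    have rep: "A \<in> Reps" by (rule subsetD[OF LIReps_Reps A(2)])
    have "C \<in> M // R" unfolding quotient by (rule image_eqI[where f = "\<lambda>A. R `` {A}", OF A(1) rep])
    moreover have "locally_interacting B {0}" if "B \<in> C" for B
      using that LI_class[of B A] LI_rep[OF rep] A by simp
    ultimately show "C \<in> LI" unfolding LI_def by simp
  qed
  have "inj_on (\<lambda>A. R `` {A}) LIReps" by (rule inj_on_subset[OF inj LIReps_Reps])
  moreover have "inj_on automaton (set synchronizing_tables)"
    by (rule inj_on_subset[OF inj_automaton]) (simp add: rep_tables_def)
  ultimately have card_LI: "card LI = 3"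
    unfolding LI by (simp only: card_image LIReps_def MA_synchronizing card_reps)
  \<comment> \<open>Stronger than failing to lie in \<open>LI\<close>: a single locally interacting
    member would spread to its representative and so to the whole class.\<close>
  have not_LI: "\<forall>C \<in> M // R - LI. \<forall>A \<in> C. \<not> locally_interacting A {0}"
  proof (intro ballI notI)
    fix C A assume C: "C \<in> M // R - LI" and A: "A \<in> C" "locally_interacting A {0}"
    have "C \<in> (\<lambda>A. R `` {A}) ` Reps" using C unfolding quotient by simp
    then obtain B where B: "C = R `` {B}" "B \<in> Reps" by (rule imageE)
    then have "locally_interacting B {0}" using LI_class[of B A] A by simp
    then have "B \<in> LIReps" using LI_rep[OF B(2)] by simp
    then have "C \<in> LI" unfolding LI by (rule image_eqI[where f = "\<lambda>A. R `` {A}", OF B(1)])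
    then show False using C by simp
  qed
  show ?thesis
    unfolding Let_def M_def[symmetric] R_def[symmetric] Reps_def[symmetric] LIReps_def[symmetric] LI_def[symmetric]
    by (intro conjI card_All card_Bij card_T card_P card_TP card_M equiv card_quotient Reps_M quotient card_LI LI not_LI)
qed

end
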